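(* Let $\bar f_1,\dots,\bar f_n:\mathbb{R}^{m}\to\mathbb{R}$ be convex, with $\bar f_j$ being $\bar{\mathbf{M}}_j$-smooth and $\bar f=\frac1n\sum_j\bar f_j$ being $\bar\mu$-strongly convex, let $\bar\psi:\mathbb{R}^m\to\mathbb{R}\cup\{+\infty\}$ be convex, and consider the finite-sum problem $\min_{\bar x\in\mathbb{R}^m}\frac1n\sum_{j=1}^n\bar f_j(\bar x)+\bar\psi(\bar x)$. Let $d=mn$ and define on $\mathbb{R}^d$ $$f(x)=\frac1n\sum_{j=1}^n\bar f_j(x_{R_j}),\qquad \psi(x)=I(x)+\bar\psi(x_{R_1}),$$ where $I$ is the indicator function of $\{x\in\mathbb{R}^d: x_{R_1}=\dots=x_{R_n}\}$. Let $x^0=Q(\bar x^0)$, let $\bar S\subseteq\{1,\dots,n\}$ be a random set, $S:=\bigcup_{j\in\bar S}R_j$ and $\alpha:=n\bar\alpha$. Then running SEGA (respectively SVRCD) on $\min_{x\in\mathbb{R}^d}f(x)+\psi(x)$ with starting point $x^0$, random set $S$ and stepsize $\alpha$ is equivalent to running SAGA (respectively L-SVRG) on the finite-sum problem with starting point $\bar x^0$, random set $\bar S$ and stepsize $\bar\alpha$; i.e., for all $k$, $$x^k=Q(\bar x^k),$$ where $x^k$ are the iterates of SEGA (SVRCD) and $\bar x^k$ those of SAGA (L-SVRG), both run with the same realizations of the random sets (and, for SVRCD/L-SVRG, the same probability $\rho$ and the same coin tosses).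
   Context: Notation: $R_j=\{m(j-1)+1,\dots,mj\}$, $x_{R_j}\in\mathbb{R}^m$ is the corresponding block of $x\in\mathbb{R}^{mn}$; the lifting operator $Q:\mathbb{R}^m\to\mathbb{R}^{mn}$ is $Q(\bar x)=(\bar x^\top,\dots,\bar x^\top)^\top$ ($n$ copies). The indicator function of a set equals $0$ on the set and $+\infty$ outside. $\bar f_j$ is $\bar{\mathbf{M}}_j$-smooth if $\bar f_j(x)\le\bar f_j(y)+\langle\nabla\bar f_j(y),x-y\rangle+\frac12\langle\bar{\mathbf{M}}_j(x-y),x-y\rangle$ for all $x,y$. $\mathrm{prox}_{\alpha\psi}(x)=\arg\min_y\{\alpha\psi(y)+\frac12\|y-x\|^2\}$, assumed well defined (e.g. $\bar\psi$ proper, closed, convex). SEGA and SVRCD: start from $x^0$, $h^0=0\in\mathbb{R}^d$, and let $p_i=\mathbb{P}(i\in S)>0$. At iteration $k$ sample $S$, put $g^k=\sum_{i\in S}\frac1{p_i}(\nabla_if(x^k)-h^k_i)e_i+h^k$ and $x^{k+1}=\mathrm{prox}_{\alpha\psi}(x^k-\alpha g^k)$. SEGA: $h^{k+1}=h^k+\sum_{i\in S}(\nabla_if(x^k)-h_i^k)e_i$. SVRCD: $h^{k+1}=\nabla f(x^k)$ with probability $\rho$, $h^{k+1}=h^k$ with probability $1-\rho$. SAGA and L-SVRG: start from $\bar x^0$, $\mathbf{J}^0=0\in\mathbb{R}^{m\times n}$, and let $\bar p_j=\mathbb{P}(j\in\bar S)>0$. At iteration $k$ sample $\bar S$, put $\bar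 g^k=\frac1n\mathbf{J}^ke+\frac1n\sum_{j\in\bar S}\frac1{\bar p_j}(\nabla\bar f_j(\bar x^k)-\mathbf{J}^k_{:,j})$, with $e\in\mathbb{R}^n$ the vector of ones, and $\bar x^{k+1}=\mathrm{prox}_{\bar\alpha\bar\psi}(\bar x^k-\bar\alpha\bar g^k)$. SAGA: $\mathbf{J}^{k+1}_{:,j}=\nabla\bar f_j(\bar x^k)$ if $j\in\bar S$, and $\mathbf{J}^{k+1}_{:,j}=\mathbf{J}^k_{:,j}$ otherwise. L-SVRG: $\mathbf{J}^{k+1}=[\nabla\bar f_1(\bar x^k),\dots,\nabla\bar f_n(\bar x^k)]$ with probability $\rho$, $\mathbf{J}^{k+1}=\mathbf{J}^k$ with probability $1-\rho$. *)

theory Defs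
  imports "HOL-Probability.Probability"
begin

definition grad :: "('a::real_inner \<Rightarrow> real) \<Rightarrow> 'a \<Rightarrow> 'a" where
  "grad f x = (THE g. GDERIV f x :> g)"

definition matrix_smooth :: "real^'k^'k \<Rightarrow> (real^'k::finite \<Rightarrow> real) \<Rightarrow> bool" where
  "matrix_smooth M f \<longleftrightarrow> (\<forall>x. f differentiable (at x)) \<and>
     (\<forall>x y. f x \<le> f y + grad f y \<bullet> (x - y) + 1/2 * ((M *v (x - y)) \<bullet> (x - y)))"

definition strongly_convex :: "real \<Rightarrow> ('a::real_inner \<Rightarrow> real) \<Rightarrow> bool" where
  "strongly_convex \<mu> f \<longleftrightarrow> \<mu> > 0 \<and>
     (\<forall>x y. f x \<ge> f y + grad f y \<bullet> (x - y) + \<mu>/2 * (norm (x - y))\<^sup>2)"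

text \<open>Convexity for functions with values in \<open>\<real> \<union> {+\<infinity>}\<close>. At the endpoints \<open>t = 0, 1\<close> the convention
  \<open>0 * \<infinity> = 0\<close> of \<^typ>\<open>ereal\<close> makes the inequality trivial.\<close>

definition convex_ext :: "('a::real_vector \<Rightarrow> ereal) \<Rightarrow> bool" where
  "convex_ext \<psi> \<longleftrightarrow> (\<forall>x. \<psi> x \<noteq> -\<infinity>) \<and>
     (\<forall>x y. \<forall>t\<in>{0..1}. \<psi> (t *\<^sub>R x + (1 - t) *\<^sub>R y) \<le> ereal t * \<psi> x + ereal (1 - t) * \<psi> y)"

definition set_indicator :: "'a set \<Rightarrow> 'a \<Rightarrow> ereal" where
  "set_indicator C x = (if x \<in> C then 0 else \<infinity>)"

definition prox_objective ::
    "real \<Rightarrow> ('a::real_normed_vector \<Rightarrow> ereal) \<Rightarrow> 'a \<Rightarrow> 'a \<Rightarrow> ereal" where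
  "prox_objective \<alpha> \<psi> x y = ereal \<alpha> * \<psi> y + ereal (1/2 * (norm (y - x))\<^sup>2)"

definition prox :: "real \<Rightarrow> ('a::real_normed_vector \<Rightarrow> ereal) \<Rightarrow> 'a \<Rightarrow> 'a" where
  "prox \<alpha> \<psi> x = (ARG_MIN (prox_objective \<alpha> \<psi> x) y. True)"

definition prox_well_defined :: "real \<Rightarrow> ('a::real_normed_vector \<Rightarrow> ereal) \<Rightarrow> bool" where
  "prox_well_defined \<alpha> \<psi> \<longleftrightarrow> (\<forall>x. \<exists>!y. is_arg_min (prox_objective \<alpha> \<psi> x) (\<lambda>_. True) y)"

definition iid_draws :: "'w measure \<Rightarrow> 'a pmf \<Rightarrow> (nat \<Rightarrow> 'w \<Rightarrow> 'a) \<Rightarrow> bool" where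
  "iid_draws P D X \<longleftrightarrow>
     prob_space.indep_vars P (\<lambda>_. count_space UNIV) X UNIV \<and>
     (\<forall>k. distr P (count_space UNIV) (X k) = measure_pmf D)"

definition incl_prob :: "'i set pmf \<Rightarrow> 'i \<Rightarrow> real" where
  "incl_prob D i = measure_pmf.prob D {A. i \<in> A}"

text \<open>In all four algorithms \<open>D\<close> is the law of the random set (it enters only through the inclusion
  probabilities), \<open>S k\<close> is the realization of the set used at iteration \<open>k\<close>, and \<open>c k\<close> the outcome
  of the coin toss (\<^const>\<open>True\<close> has probability \<open>\<rho>\<close>). The state is the pair of the iterate and the
  control variates.\<close>

definition coord_estimator ::
    "(real^'d::finite \<Rightarrow> real) \<Rightarrow> 'd set pmf \<Rightarrow> 'd set \<Rightarrow> real^'d \<Rightarrow> real^'d \<Rightarrow> real^'d" where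
  "coord_estimator f D S x h =
     (\<Sum>i\<in>S. (1 / incl_prob D i * (grad f x $ i - h $ i)) *\<^sub>R axis i 1) + h"

primrec sega :: "(real^'d::finite \<Rightarrow> real) \<Rightarrow> (real^'d \<Rightarrow> ereal) \<Rightarrow> real^'d \<Rightarrow> real \<Rightarrow>
    'd set pmf \<Rightarrow> (nat \<Rightarrow> 'd set) \<Rightarrow> nat \<Rightarrow> (real^'d) \<times> (real^'d)" where
  "sega f \<psi> x0 \<alpha> D S 0 = (x0, 0)"
| "sega f \<psi> x0 \<alpha> D S (Suc k) = (let (x, h) = sega f \<psi> x0 \<alpha> D S k in
     (prox \<alpha> \<psi> (x - \<alpha> *\<^sub>R coord_estimator f D (S k) x h),
      h + (\<Sum>i\<in>S k. (grad f x $ i - h $ i) *\<^sub>R axis i 1)))"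

primrec svrcd :: "(real^'d::finite \<Rightarrow> real) \<Rightarrow> (real^'d \<Rightarrow> ereal) \<Rightarrow> real^'d \<Rightarrow> real \<Rightarrow>
    'd set pmf \<Rightarrow> (nat \<Rightarrow> 'd set) \<Rightarrow> (nat \<Rightarrow> bool) \<Rightarrow> nat \<Rightarrow> (real^'d) \<times> (real^'d)" where
  "svrcd f \<psi> x0 \<alpha> D S c 0 = (x0, 0)"
| "svrcd f \<psi> x0 \<alpha> D S c (Suc k) = (let (x, h) = svrcd f \<psi> x0 \<alpha> D S c k in
     (prox \<alpha> \<psi> (x - \<alpha> *\<^sub>R coord_estimator f D (S k) x h),
      if c k then grad f x else h))"

text \<open>A matrix in \<open>\<real>\<^bsup>m\<times>n\<^esup>\<close> has type \<open>real^'n^'m\<close>.\<close>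

definition finsum_estimator :: "('n::finite \<Rightarrow> real^'m::finite \<Rightarrow> real) \<Rightarrow> 'n set pmf \<Rightarrow> 'n set \<Rightarrow>
    real^'m \<Rightarrow> real^'n^'m \<Rightarrow> real^'m" where
  "finsum_estimator fs D S x J =
     (1 / real CARD('n)) *\<^sub>R (J *v (\<chi> j. 1)) +
     (1 / real CARD('n)) *\<^sub>R (\<Sum>j\<in>S. (1 / incl_prob D j) *\<^sub>R (grad (fs j) x - column j J))"

primrec saga :: "('n::finite \<Rightarrow> real^'m::finite \<Rightarrow> real) \<Rightarrow> (real^'m \<Rightarrow> ereal) \<Rightarrow> real^'m \<Rightarrow> real \<Rightarrow>
    'n set pmf \<Rightarrow> (nat \<Rightarrow> 'n set) \<Rightarrow> nat \<Rightarrow> (real^'m) \<times> (real^'n^'m)" where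
  "saga fs \<psi> x0 \<alpha> D S 0 = (x0, 0)"
| "saga fs \<psi> x0 \<alpha> D S (Suc k) = (let (x, J) = saga fs \<psi> x0 \<alpha> D S k in
     (prox \<alpha> \<psi> (x - \<alpha> *\<^sub>R finsum_estimator fs D (S k) x J),
      \<chi> i j. if j \<in> S k then grad (fs j) x $ i else J $ i $ j))"

primrec lsvrg :: "('n::finite \<Rightarrow> real^'m::finite \<Rightarrow> real) \<Rightarrow> (real^'m \<Rightarrow> ereal) \<Rightarrow> real^'m \<Rightarrow> real \<Rightarrow>
    'n set pmf \<Rightarrow> (nat \<Rightarrow> 'n set) \<Rightarrow> (nat \<Rightarrow> bool) \<Rightarrow> nat \<Rightarrow> (real^'m) \<times> (real^'n^'m)" where
  "lsvrg fs \<psi> x0 \<alpha> D S c 0 = (x0, 0)"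
| "lsvrg fs \<psi> x0 \<alpha> D S c (Suc k) = (let (x, J) = lsvrg fs \<psi> x0 \<alpha> D S c k in
     (prox \<alpha> \<psi> (x - \<alpha> *\<^sub>R finsum_estimator fs D (S k) x J),
      if c k then (\<chi> i j. grad (fs j) x $ i) else J))"

text \<open>\<open>\<real>\<^bsup>mn\<^esup>\<close> is \<open>real^('n \<times> 'm)\<close>: the coordinate \<open>(j, i)\<close> is the \<open>i\<close>-th coordinate of the \<open>j\<close>-th
  block, i.e. coordinate number \<open>m(j - 1) + i\<close> when \<open>'n\<close> and \<open>'m\<close> are numbered from \<open>1\<close>.\<close>

definition block_idx :: "'n \<Rightarrow> ('n \<times> 'm) set" where
  "block_idx j = {j} \<times> UNIV"

definition block :: "real^('n::finite \<times> 'm::finite) \<Rightarrow> 'n \<Rightarrow> real^'m" where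
  "block x j = (\<chi> i. x $ (j, i))"

definition lift_Q :: "real^'m::finite \<Rightarrow> real^('n::finite \<times> 'm)" where
  "lift_Q z = (\<chi> p. z $ snd p)"

definition lift_fun :: "('n::finite \<Rightarrow> real^'m::finite \<Rightarrow> real) \<Rightarrow> real^('n \<times> 'm) \<Rightarrow> real" where
  "lift_fun fs x = 1 / real CARD('n) * (\<Sum>j\<in>UNIV. fs j (block x j))"

text \<open>The argument \<open>j1\<close> is the index of the first block; a finite type has no distinguished one.\<close>

definition lift_reg ::
    "'n::finite \<Rightarrow> (real^'m::finite \<Rightarrow> ereal) \<Rightarrow> real^('n \<times> 'm) \<Rightarrow> ereal" where
  "lift_reg j1 \<psi> x = set_indicator {x. \<forall>j l. block x j = block x l} x + \<psi> (block x j1)"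

definition lift_set :: "'n set \<Rightarrow> ('n \<times> 'm) set" where
  "lift_set A = (\<Union>j\<in>A. block_idx j)"

end

theory Submission
  imports Defs
begin

text \<open>
  One step of the lifted method is the image of one step of the finite-sum method under a fixed
  correspondence of states: the iterate \<open>z\<close> corresponds to the stacked copies \<open>Q(z)\<close>, and the matrix
  \<open>J\<close> of control variates to the vector whose \<open>j\<close>-th block is \<open>J\<^sub>:\<^sub>,\<^sub>j / n\<close>. This scaling is forced by
  \<open>f = (1/n) \<Sum>\<^sub>j f\<^sub>j(x\<^sub>R\<^sub>j)\<close>, whose gradient at \<open>Q(z)\<close> has \<open>j\<close>-th block \<open>\<nabla>f\<^sub>j(z) / n\<close>; with it, both rules
  for updating the control variates correspond block by block.

  The iterates correspond because the proximal operator of the lifted regularizer sees its argument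
  only through the mean of the blocks. Minimizing over the diagonal means minimizing
  \<open>n \<alpha> \<psi>(z) + \<Sum>\<^sub>j \<parallel>z - y\<^sub>j\<parallel>\<^sup>2 / 2\<close> over \<open>z\<close>, and since the deviations of the \<open>y\<^sub>j\<close> from their mean \<open>y\<close> sum to zero,
  this is \<open>n (\<alpha> \<psi>(z) + \<parallel>z - y\<parallel>\<^sup>2 / 2)\<close> plus a constant; hence \<open>prox\<close> of the lifted problem equals \<open>Q\<close>
  of \<open>prox\<close> at the mean (\<open>prox_lift_reg\<close>). The mean of the blocks of the lifted gradient
  estimator is the finite-sum estimator divided by \<open>n\<close> (\<open>block_mean_coord_estimator\<close>), and the
  stepsize \<open>n \<alpha>\<close> cancels this factor.

  The correspondence is pathwise. It uses the law of the random set only through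
  \<open>P((j, i) \<in> S) = P(j \<in> S')\<close>, where \<open>S'\<close> is the sampled set of blocks.
\<close>

section \<open>Gradients of lifted functions\<close>

lemma grad_eqI:
  assumes "GDERIV f x :> g"
  shows "grad f x = g"
  unfolding grad_def
proof (rule the_equality[of "\<lambda>g. GDERIV f x :> g", OF assms])
  fix g' assume "GDERIV f x :> g'"
  then have "(\<lambda>h. h \<bullet> g') = (\<lambda>h. h \<bullet> g)"
    using assms unfolding gderiv_def by (rule has_derivative_unique)
  then have "h \<bullet> g' = h \<bullet> g" for h
    by (rule fun_cong)
  then show "g' = g"
    by (metis vector_eq_ldot)
qed

text \<open>By the Riesz representation of linear functionals, here through the adjoint, a differentiable
  function has a gradient, so that \<open>grad\<close> is not a default value.\<close>

lemma GDERIV_grad: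
  fixes f :: "'a::euclidean_space \<Rightarrow> real"
  assumes "f differentiable (at x)"
  shows "GDERIV f x :> grad f x"
proof -
  obtain f' where f': "(f has_derivative f') (at x)"
    using assms unfolding differentiable_def by blast
  have "f' h = h \<bullet> adjoint f' 1" for h
    using adjoint_works[of f' h 1] has_derivative_linear[OF f'] by simp
  then have "f' = (\<lambda>h. h \<bullet> adjoint f' 1)"
    by auto
  then have "GDERIV f x :> adjoint f' 1"
    using f' unfolding gderiv_def by metis
  with grad_eqI[OF this] show ?thesis
    by simp
qed

lemma block_lift_Q [simp]: "block (lift_Q z) j = z"
  by (simp add: block_def lift_Q_def)

lemma bounded_linear_block: "bounded_linear (\<lambda>x. block x j)"
  by (intro linear_conv_bounded_linear[THEN iffD1] linearI) (simp_all add: block_def vec_eq_iff)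

lemma sum_prod_blocks:
  "(\<Sum>p\<in>(UNIV :: ('n::finite \<times> 'm::finite) set). F p) = (\<Sum>j\<in>UNIV. \<Sum>i\<in>UNIV. F (j, i))"
  by (simp add: sum.cartesian_product UNIV_Times_UNIV[symmetric] del: UNIV_Times_UNIV)

lemma inner_blocks:
  fixes x y :: "real^('n::finite \<times> 'm::finite)"
  shows "x \<bullet> y = (\<Sum>j\<in>UNIV. block x j \<bullet> block y j)"
  by (simp add: inner_vec_def block_def sum_prod_blocks)

lemma grad_lift_fun:
  fixes fs :: "'n::finite \<Rightarrow> real^'m::finite \<Rightarrow> real"
  assumes "\<And>j. fs j differentiable (at (block x j))"
  shows "grad (lift_fun fs) x = (\<chi> p. grad (fs (fst p)) (block x (fst p)) $ snd p / real CARD('n))"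
    (is "_ = ?g")
proof (rule grad_eqI)
  have "((\<lambda>x. fs j (block x j)) has_derivative (\<lambda>h. block h j \<bullet> grad (fs j) (block x j))) (at x)" for j
    using has_derivative_compose[OF bounded_linear_imp_has_derivative[OF bounded_linear_block]]
      GDERIV_grad[OF assms[of j]]
    unfolding gderiv_def by fast
  then have "(lift_fun fs has_derivative
      (\<lambda>h. 1 / real CARD('n) * (\<Sum>j\<in>UNIV. block h j \<bullet> grad (fs j) (block x j)))) (at x)"
    unfolding lift_fun_def by (intro has_derivative_mult_right has_derivative_sum)
  moreover have "1 / real CARD('n) * (\<Sum>j\<in>UNIV. block h j \<bullet> grad (fs j) (block x j)) = h \<bullet> ?g" for h
    by (simp add: inner_blocks inner_vec_def block_def sum_divide_distrib)
  ultimately show "GDERIV (lift_fun fs) x :> ?g"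
    by (simp add: gderiv_def)
qed

section \<open>The proximal operator of the lifted regularizer\<close>

definition block_mean :: "real^('n::finite \<times> 'm::finite) \<Rightarrow> real^'m" where
  "block_mean y = (1 / real CARD('n)) *\<^sub>R (\<Sum>j\<in>UNIV. block y j)"

lemma linear_block_mean: "linear block_mean"
  by (intro linearI)
    (simp_all add: block_mean_def block_def vec_eq_iff sum.distrib sum_distrib_left algebra_simps)

lemma block_mean_lift_Q [simp]: "block_mean (lift_Q z) = z"
  by (simp add: block_mean_def sum_constant_scaleR del: sum_constant)

text \<open>The cross term of the expansion around the mean vanishes (Huygens-Steiner identity).\<close>

lemma norm_lift_Q_diff:
  fixes y :: "real^('n::finite \<times> 'm::finite)"
  shows "(norm (lift_Q z - y))\<^sup>2 =
    real CARD('n) * (norm (z - block_mean y))\<^sup>2 + (norm (lift_Q (block_mean y) - y))\<^sup>2"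
proof -
  let ?b = "block_mean y"
  have sum_dev: "(\<Sum>j\<in>UNIV. ?b - block y j) = 0"
    by (simp add: sum_subtractf block_mean_def sum_constant_scaleR del: sum_constant)
  have block_diff: "block (lift_Q w - y) j = w - block y j" for w j
    by (simp add: block_def lift_Q_def vec_eq_iff)
  have expand: "(z - block y j) \<bullet> (z - block y j) = (z - ?b) \<bullet> (z - ?b)
      + 2 * ((z - ?b) \<bullet> (?b - block y j)) + (?b - block y j) \<bullet> (?b - block y j)" for j
    by (simp add: algebra_simps inner_commute)
  have "(\<Sum>j\<in>UNIV. (z - ?b) \<bullet> (?b - block y j)) = 0"
    using sum_dev by (metis inner_sum_right inner_zero_right)
  then show ?thesis
    unfolding power2_norm_eq_inner inner_blocks block_diff expand
    by (simp add: sum.distrib sum_distrib_left[symmetric])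
qed

lemma prox_objective_lift_Q:
  fixes y :: "real^('n::finite \<times> 'm::finite)"
  shows "prox_objective (real CARD('n) * \<alpha>) (lift_reg j1 \<psi>) y (lift_Q z) =
    ereal (real CARD('n)) * prox_objective \<alpha> \<psi> (block_mean y) z
      + ereal (1/2 * (norm (lift_Q (block_mean y) - y))\<^sup>2)"
proof -
  have split: "ereal (1/2 * (norm (lift_Q z - y))\<^sup>2) =
      ereal (real CARD('n)) * ereal (1/2 * (norm (z - block_mean y))\<^sup>2)
        + ereal (1/2 * (norm (lift_Q (block_mean y) - y))\<^sup>2)"
    using norm_lift_Q_diff[of z y] by (simp add: add_divide_distrib)
  have assoc: "ereal (real CARD('n) * \<alpha>) * \<psi> z = ereal (real CARD('n)) * (ereal \<alpha> * \<psi> z)"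
    by (metis mult.assoc times_ereal.simps(1))
  have distrib: "ereal (real CARD('n)) * (a + b) = ereal (real CARD('n)) * a + ereal (real CARD('n)) * b"
    for a b
    by (rule ereal_pos_distrib) simp_all
  have "lift_reg j1 \<psi> (lift_Q z :: real^('n \<times> 'm)) = \<psi> z"
    by (simp add: lift_reg_def set_indicator_def)
  then show ?thesis
    unfolding prox_objective_def split distrib by (simp only: assoc add.assoc)
qed

lemma prox_objective_off_diagonal:
  fixes x y :: "real^('n::finite \<times> 'm::finite)"
  assumes "\<alpha> > 0" and "\<And>z. \<psi> z \<noteq> -\<infinity>" and "x \<notin> range lift_Q"
  shows "prox_objective \<alpha> (lift_reg j1 \<psi>) y x = \<infinity>"
proof -
  have "\<not> (\<forall>j l. block x j = block x l)"
  proof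
    assume "\<forall>j l. block x j = block x l"
    then have "x = lift_Q (block x j1)"
      by (auto simp: vec_eq_iff lift_Q_def block_def)
    with assms(3) show False by blast
  qed
  then have "lift_reg j1 \<psi> x = \<infinity>"
    using assms(2) by (auto simp: lift_reg_def set_indicator_def)
  with assms(1) show ?thesis
    by (simp add: prox_objective_def)
qed

lemma prox_eqI:
  assumes "is_arg_min (prox_objective \<alpha> \<psi> x) (\<lambda>_. True) z"
    and "\<And>w. is_arg_min (prox_objective \<alpha> \<psi> x) (\<lambda>_. True) w \<Longrightarrow> w = z"
  shows "prox \<alpha> \<psi> x = z"
  unfolding prox_def arg_min_def using assms by (rule some_equality)

lemma is_arg_min_prox:
  assumes "prox_well_defined \<alpha> \<psi>"
  shows "is_arg_min (prox_objective \<alpha> \<psi> x) (\<lambda>_. True) (prox \<alpha> \<psi> x)"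
  using assms unfolding prox_well_defined_def prox_def arg_min_def by (metis someI_ex)

text \<open>If the minimal value were \<open>\<infinity>\<close>, every point would be a minimizer, and the space has more than
  one point. Thus uniqueness of minimizers makes \<open>\<psi>\<close> proper.\<close>

lemma prox_objective_prox_finite:
  fixes x :: "real^'m::finite"
  assumes "prox_well_defined \<alpha> \<psi>"
  shows "prox_objective \<alpha> \<psi> x (prox \<alpha> \<psi> x) < \<infinity>"
proof (rule ccontr)
  assume "\<not> ?thesis"
  then have inf: "prox_objective \<alpha> \<psi> x (prox \<alpha> \<psi> x) = \<infinity>"
    by simp
  have "prox_objective \<alpha> \<psi> x w = \<infinity>" for w
    using is_arg_min_prox[OF assms, of x] inf by (simp add: is_arg_min_def)
  then have "is_arg_min (prox_objective \<alpha> \<psi> x) (\<lambda>_. True) w" for w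
    by (simp add: is_arg_min_def)
  moreover have "(0 :: real^'m) \<noteq> (\<chi> i. 1)"
    by (simp add: vec_eq_iff)
  ultimately show False
    using assms unfolding prox_well_defined_def by metis
qed

text \<open>On the diagonal the lifted objective is an increasing function of the original one, and
  off the diagonal it is \<open>\<infinity>\<close>, which exceeds the minimal value. So the lifted minimizers are
  exactly the lifts of the original ones.\<close>

lemma prox_lift_reg:
  fixes y :: "real^('n::finite \<times> 'm::finite)"
  assumes "\<alpha> > 0" and not_minf: "\<And>z. \<psi> z \<noteq> -\<infinity>" and wd: "prox_well_defined \<alpha> \<psi>"
  shows "prox (real CARD('n) * \<alpha>) (lift_reg j1 \<psi>) y = lift_Q (prox \<alpha> \<psi> (block_mean y))"
proof -
  let ?F = "prox_objective (real CARD('n) * \<alpha>) (lift_reg j1 \<psi>) y"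
  let ?G = "prox_objective \<alpha> \<psi> (block_mean y)"
  let ?z = "prox \<alpha> \<psi> (block_mean y)"
  have diag: "?F (lift_Q w) < ?F (lift_Q z) \<longleftrightarrow> ?G w < ?G z" for w z
    unfolding prox_objective_lift_Q
    by (cases "?G w"; cases "?G z") auto
  have off: "?F x = \<infinity>" if "x \<notin> range lift_Q" for x
    by (rule prox_objective_off_diagonal) (use assms(1) not_minf that in auto)
  have min: "\<not> ?G w < ?G ?z" for w
    using is_arg_min_prox[OF wd] by (auto simp: is_arg_min_def)
  have fin: "?F (lift_Q ?z) < \<infinity>"
    using prox_objective_prox_finite[OF wd, of "block_mean y"] unfolding prox_objective_lift_Q
    by (cases "?G ?z") auto
  show ?thesis
  proof (rule prox_eqI)
    have "\<not> ?F x < ?F (lift_Q ?z)" for x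
      using off[of x] diag min by (cases "x \<in> range lift_Q") auto
    then show "is_arg_min ?F (\<lambda>_. True) (lift_Q ?z)"
      by (simp add: is_arg_min_def)
  next
    fix x assume x: "is_arg_min ?F (\<lambda>_. True) x"
    then have "x \<in> range lift_Q"
      using off[of x] fin unfolding is_arg_min_def by metis
    then obtain w where w: "x = lift_Q w"
      by blast
    have "is_arg_min ?G (\<lambda>_. True) w"
      using x diag unfolding w is_arg_min_def by blast
    then have "w = ?z"
      using wd is_arg_min_prox[OF wd] unfolding prox_well_defined_def by blast
    with w show "x = lift_Q ?z"
      by simp
  qed
qed

section \<open>Correspondence of states\<close>

lemma mem_lift_set [simp]: "p \<in> lift_set A \<longleftrightarrow> fst p \<in> A"
  by (cases p) (auto simp: lift_set_def block_idx_def)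

lemma incl_prob_lift_set: "incl_prob (map_pmf lift_set D) p = incl_prob D (fst p)"
  by (simp add: incl_prob_def vimage_def)

text \<open>The factor \<open>1/n\<close> makes the gradient of the lifted function at \<open>Q(z)\<close> the image of the matrix of
  gradients at \<open>z\<close>.\<close>

definition stack_columns :: "real^'n^'m \<Rightarrow> real^('n::finite \<times> 'm::finite)" where
  "stack_columns J = (\<chi> p. J $ snd p $ fst p / real CARD('n))"

lemma grad_lift_fun_lift_Q:
  fixes fs :: "'n::finite \<Rightarrow> real^'m::finite \<Rightarrow> real"
  assumes "\<And>j. fs j differentiable (at z)"
  shows "grad (lift_fun fs) (lift_Q z) = stack_columns (\<chi> i j. grad (fs j) z $ i)"
  using grad_lift_fun[of fs "lift_Q z"] assms by (simp add: stack_columns_def)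

lemma sum_axis_eq_vec_lambda:
  "(\<Sum>i\<in>S. a i *\<^sub>R axis i (1 :: real)) = (\<chi> k :: 'd::finite. if k \<in> S then a k else 0)"
proof -
  have "(\<Sum>i\<in>S. a i * axis i 1 $ k) = (\<Sum>i\<in>S. if k = i then a i else 0)" for k
    by (rule sum.cong) (auto simp: axis_def)
  then show ?thesis
    by (simp add: vec_eq_iff)
qed

lemma stack_columns_sega_update:
  fixes fs :: "'n::finite \<Rightarrow> real^'m::finite \<Rightarrow> real"
  assumes "\<And>j. fs j differentiable (at z)"
  shows "stack_columns J + (\<Sum>p\<in>lift_set A.
      (grad (lift_fun fs) (lift_Q z) $ p - stack_columns J $ p) *\<^sub>R axis p 1) =
    stack_columns (\<chi> i j. if j \<in> A then grad (fs j) z $ i else J $ i $ j)"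
  unfolding grad_lift_fun_lift_Q[OF assms] sum_axis_eq_vec_lambda
  by (simp add: vec_eq_iff stack_columns_def)

text \<open>Block \<open>j\<close> of the lifted estimator is exactly the \<open>j\<close>-th summand of the finite-sum estimator
  (with its factor \<open>1/n\<close>), so the blocks add up to that estimator, and their mean has one more
  factor \<open>1/n\<close>.\<close>

lemma block_mean_coord_estimator:
  fixes fs :: "'n::finite \<Rightarrow> real^'m::finite \<Rightarrow> real"
  assumes "\<And>j. fs j differentiable (at z)"
  shows "block_mean (coord_estimator (lift_fun fs) (map_pmf lift_set D) (lift_set A)
      (lift_Q z) (stack_columns J)) = (1 / real CARD('n)) *\<^sub>R finsum_estimator fs D A z J"
proof -
  let ?g = "coord_estimator (lift_fun fs) (map_pmf lift_set D) (lift_set A)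
      (lift_Q z) (stack_columns J)"
  let ?c = "\<lambda>j. 1 / incl_prob D j"
  have g: "?g $ (j, i) = (1 / real CARD('n)) *
      ((if j \<in> A then ?c j * (grad (fs j) z $ i - J $ i $ j) else 0) + J $ i $ j)" for i j
    unfolding coord_estimator_def grad_lift_fun_lift_Q[OF assms] sum_axis_eq_vec_lambda
    by (simp add: incl_prob_lift_set stack_columns_def diff_divide_distrib add_divide_distrib
        right_diff_distrib)
  have sum_g: "(\<Sum>j\<in>UNIV. ?g $ (j, i)) = finsum_estimator fs D A z J $ i" for i
    unfolding g finsum_estimator_def
    by (simp add: matrix_vector_mult_def column_def sum.distrib sum_distrib_left[symmetric]
        sum_divide_distrib[symmetric] sum.If_cases add_divide_distrib)
  show ?thesis
    by (simp add: vec_eq_iff block_mean_def block_def sum_g)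
qed

lemma prox_step_lift:
  fixes fs :: "'n::finite \<Rightarrow> real^'m::finite \<Rightarrow> real"
  assumes "\<And>j. fs j differentiable (at z)"
    and "\<alpha> > 0" and "\<And>z. \<psi> z \<noteq> -\<infinity>" and "prox_well_defined \<alpha> \<psi>"
  shows "prox (real CARD('n) * \<alpha>) (lift_reg j1 \<psi>) (lift_Q z - (real CARD('n) * \<alpha>) *\<^sub>R
      coord_estimator (lift_fun fs) (map_pmf lift_set D) (lift_set A) (lift_Q z) (stack_columns J)) =
    lift_Q (prox \<alpha> \<psi> (z - \<alpha> *\<^sub>R finsum_estimator fs D A z J))"
  by (simp add: prox_lift_reg[OF assms(2-4)] linear_diff[OF linear_block_mean]
      linear_scale[OF linear_block_mean] block_mean_coord_estimator[OF assms(1)])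

lemma sega_lift:
  fixes fs :: "'n::finite \<Rightarrow> real^'m::finite \<Rightarrow> real"
  assumes diff: "\<And>j z. fs j differentiable (at z)"
    and prox: "\<alpha> > 0" "\<And>z. \<psi> z \<noteq> -\<infinity>" "prox_well_defined \<alpha> \<psi>"
  shows "sega (lift_fun fs) (lift_reg j1 \<psi>) (lift_Q z0) (real CARD('n) * \<alpha>)
      (map_pmf lift_set D) (\<lambda>k. lift_set (A k)) k =
    map_prod lift_Q stack_columns (saga fs \<psi> z0 \<alpha> D A k)"
proof (induction k)
  case 0
  show ?case
    by (simp add: stack_columns_def vec_eq_iff)
next
  case (Suc k)
  obtain z J where "saga fs \<psi> z0 \<alpha> D A k = (z, J)"
    by fastforce
  with Suc show ?case
    by (simp add: prox_step_lift[OF diff prox] stack_columns_sega_update[OF diff])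
qed

lemma svrcd_lift:
  fixes fs :: "'n::finite \<Rightarrow> real^'m::finite \<Rightarrow> real"
  assumes diff: "\<And>j z. fs j differentiable (at z)"
    and prox: "\<alpha> > 0" "\<And>z. \<psi> z \<noteq> -\<infinity>" "prox_well_defined \<alpha> \<psi>"
  shows "svrcd (lift_fun fs) (lift_reg j1 \<psi>) (lift_Q z0) (real CARD('n) * \<alpha>)
      (map_pmf lift_set D) (\<lambda>k. lift_set (A k)) c k =
    map_prod lift_Q stack_columns (lsvrg fs \<psi> z0 \<alpha> D A c k)"
proof (induction k)
  case 0
  show ?case
    by (simp add: stack_columns_def vec_eq_iff)
next
  case (Suc k)
  obtain z J where "lsvrg fs \<psi> z0 \<alpha> D A c k = (z, J)"
    by fastforce
  with Suc show ?case
    by (simp add: prox_step_lift[OF diff prox] grad_lift_fun_lift_Q[OF diff])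
qed

section \<open>Equivalence of the methods\<close>

theorem lemma3p3:
  fixes fbar :: "'n::finite \<Rightarrow> real^'m::finite \<Rightarrow> real"
    and Mbar :: "'n \<Rightarrow> real^'m^'m"
    and \<mu>bar \<alpha>bar :: real
    and \<psi>bar :: "real^'m \<Rightarrow> ereal"
    and xbar0 :: "real^'m"
    and j1 :: 'n
    and P :: "'w measure"
    and Dbar :: "'n set pmf"
    and Sbar :: "nat \<Rightarrow> 'w \<Rightarrow> 'n set"
  defines "f \<equiv> (lift_fun fbar :: real^('n \<times> 'm) \<Rightarrow> real)"
    and "\<psi> \<equiv> (lift_reg j1 \<psi>bar :: real^('n \<times> 'm) \<Rightarrow> ereal)"
    and "x0 \<equiv> (lift_Q xbar0 :: real^('n \<times> 'm))"
    and "\<alpha> \<equiv> real CARD('n) * \<alpha>bar"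
    and "D \<equiv> (map_pmf lift_set Dbar :: ('n \<times> 'm) set pmf)"
    and "S \<equiv> (\<lambda>k \<omega>. lift_set (Sbar k \<omega>) :: ('n \<times> 'm) set)"
  assumes convex: "\<And>j. convex_on UNIV (fbar j)"
    and smooth: "\<And>j. matrix_smooth (Mbar j) (fbar j)"
    and strong: "strongly_convex \<mu>bar (\<lambda>z. 1 / real CARD('n) * (\<Sum>j\<in>UNIV. fbar j z))"
    and reg: "convex_ext \<psi>bar"
    and step: "\<alpha>bar > 0"
    and prox_wd: "prox_well_defined \<alpha>bar \<psi>bar"
    and prob: "prob_space P"
    and draws: "iid_draws P Dbar Sbar"
    and incl: "\<And>j. incl_prob Dbar j > 0"
  shows "(\<forall>\<omega>\<in>space P. \<forall>k.
            fst (sega f \<psi> x0 \<alpha> D (\<lambda>k. S k \<omega>) k)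
              = lift_Q (fst (saga fbar \<psi>bar xbar0 \<alpha>bar Dbar (\<lambda>k. Sbar k \<omega>) k)))
       \<and> (\<forall>\<rho> c. 0 \<le> \<rho> \<and> \<rho> \<le> 1 \<and>
            iid_draws P (pair_pmf Dbar (bernoulli_pmf \<rho>)) (\<lambda>k \<omega>. (Sbar k \<omega>, c k \<omega>)) \<longrightarrow>
            (\<forall>\<omega>\<in>space P. \<forall>k.
               fst (svrcd f \<psi> x0 \<alpha> D (\<lambda>k. S k \<omega>) (\<lambda>k. c k \<omega>) k)
                 = lift_Q (fst (lsvrg fbar \<psi>bar xbar0 \<alpha>bar Dbar (\<lambda>k. Sbar k \<omega>) (\<lambda>k. c k \<omega>) k))))"
proof -
  have diff: "fbar j differentiable (at z)" for j z
    using smooth unfolding matrix_smooth_def by blast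
  have not_minf: "\<psi>bar z \<noteq> -\<infinity>" for z
    using reg unfolding convex_ext_def by blast
  show ?thesis
    unfolding f_def \<psi>_def x0_def \<alpha>_def D_def S_def
    by (simp add: sega_lift[OF diff step not_minf prox_wd]
        svrcd_lift[OF diff step not_minf prox_wd])
qed

end
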